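(* Let $\Phi:\mathbb{Z}^2\to\mathbb{Z}^2$ be the map $(p,q)\mapsto\left(\frac{|p-q|-|p+q|}2,\ |p|-|q|\right)$ and let $\Phi_{\mathbb{R}}:\mathbb{R}^2\to\mathbb{R}^2$ be its extension defined by the same formulas. Then: \begin{enumerate} \item $\Phi_{\mathbb{R}}$ is piecewise-linear and area preserving. \item $\Phi_{\mathbb{R}}$ is a double covering branched at the origin, and it is even in the sense that $\Phi_{\mathbb{R}}(-(p,q))=\Phi_{\mathbb{R}}((p,q))$. \item $\Phi_{\mathbb{R}}$ sends each of the $8$ regions of $\mathbb{R}^2$ bounded by the $p$- and $q$-axes and the angle bisectors $p=\pm q$ linearly onto a quadrant of $\mathbb{R}^2$, where each such sector $X$ and its opposite $-X$ are sent to the same quadrant. \item $\Phi(\mathbb{Z}^2)=\mathbb{Z}^2$, and $\Phi$ defines a one-to-one correspondence between $\mathbb{Z}^2/(-1)$ and $\mathbb{Z}^2$, where $\mathbb{Z}^2/(-1)$ is the quotient by the involution $(p,q)\mapsto-(p,q)$. \end{enumerate}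
   Context: A quadrant of $\mathbb{R}^2$ is one of the four closed regions bounded by the coordinate axes. "Double covering branched at the origin" means that the preimage of the origin is the origin and that the restriction to $\mathbb{R}^2\setminus\{0\}\to\mathbb{R}^2\setminus\{0\}$ is a two-sheeted covering map. "Area preserving" means that each linear piece of the map has determinant of absolute value $1$. *)

theory Defs
  imports "HOL-Analysis.Analysis"
begin

definition Phi_R :: "real ^ 2 \<Rightarrow> real ^ 2" where
  "Phi_R x = vector [(\<bar>x $ 1 - x $ 2\<bar> - \<bar>x $ 1 + x $ 2\<bar>) / 2, \<bar>x $ 1\<bar> - \<bar>x $ 2\<bar>]"

(* The division below is exact, since p - q and p + q have the same parity;
   see Phi_R_extends_Phi. *)
definition Phi :: "int ^ 2 \<Rightarrow> int ^ 2" where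
  "Phi x = vector [(\<bar>x $ 1 - x $ 2\<bar> - \<bar>x $ 1 + x $ 2\<bar>) div 2, \<bar>x $ 1\<bar> - \<bar>x $ 2\<bar>]"

lemma Phi_R_extends_Phi:
  "Phi_R (\<chi> i. real_of_int (x $ i)) = (\<chi> i. real_of_int (Phi x $ i))"
proof -
  have "2 dvd \<bar>x $ 1 - x $ 2\<bar> - \<bar>x $ 1 + x $ 2\<bar>"
    by presburger
  then have "real_of_int ((\<bar>x $ 1 - x $ 2\<bar> - \<bar>x $ 1 + x $ 2\<bar>) div 2)
      = real_of_int (\<bar>x $ 1 - x $ 2\<bar> - \<bar>x $ 1 + x $ 2\<bar>) / 2"
    by (simp add: real_of_int_div)
  then show ?thesis
    by (simp add: Phi_R_def Phi_def vec_eq_iff forall_2)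
qed

(* Nonempty interior excludes lower-dimensional polyhedra, on which the affine
   map agreeing with f would not be determined by f. *)
definition linear_piece ::
    "(real ^ 2 \<Rightarrow> real ^ 2) \<Rightarrow> (real ^ 2) set \<Rightarrow> (real ^ 2 \<Rightarrow> real ^ 2) \<Rightarrow> real ^ 2 \<Rightarrow> bool" where
  "linear_piece f X L b \<longleftrightarrow>
     polyhedron X \<and> interior X \<noteq> {} \<and> linear L \<and> (\<forall>x\<in>X. f x = L x + b)"

definition piecewise_linear :: "(real ^ 2 \<Rightarrow> real ^ 2) \<Rightarrow> bool" where
  "piecewise_linear f \<longleftrightarrow>
     continuous_on UNIV f \<and>
     (\<exists>P. finite P \<and> \<Union>P = UNIV \<and> (\<forall>X\<in>P. \<exists>L b. linear_piece f X L b))"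

(* Meaningful for piecewise-linear f only. *)
definition area_preserving :: "(real ^ 2 \<Rightarrow> real ^ 2) \<Rightarrow> bool" where
  "area_preserving f \<longleftrightarrow> (\<forall>X L b. linear_piece f X L b \<longrightarrow> \<bar>det (matrix L)\<bar> = 1)"

definition double_covering_branched_at_origin :: "(real ^ 2 \<Rightarrow> real ^ 2) \<Rightarrow> bool" where
  "double_covering_branched_at_origin f \<longleftrightarrow>
     f -` {0} = {0} \<and>
     covering_space (UNIV - {0}) f (UNIV - {0}) \<and>
     (\<forall>y\<in>UNIV - {0}. card {x \<in> UNIV - {0}. f x = y} = 2)"

definition regions_bounded_by :: "(real ^ 2) set \<Rightarrow> (real ^ 2) set set" where
  "regions_bounded_by A = closure ` components (- A)"

definition quadrants :: "(real ^ 2) set set" where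
  "quadrants = regions_bounded_by {x. x $ 1 = 0 \<or> x $ 2 = 0}"

definition sectors :: "(real ^ 2) set set" where
  "sectors = regions_bounded_by {x. x $ 1 = 0 \<or> x $ 2 = 0 \<or> x $ 1 = x $ 2 \<or> x $ 1 = - x $ 2}"

definition neg_rel :: "((int ^ 2) \<times> (int ^ 2)) set" where
  "neg_rel = {(x, y). y = x \<or> y = - x}"

lemma equiv_neg_rel: "equiv UNIV neg_rel"
  by (auto simp: neg_rel_def intro!: equivI refl_onI symI transI)

end

(* The first coordinate of Phi_R (p, q) is - sgn (p q) min(|p|, |q|). So the image determines
   |p|, |q| and the sign of p q, that is, (p, q) up to a common sign, and on each of the eight
   sectors the absolute values resolve to a linear map of determinant 1. Two explicit right
   inverses, each continuous on a plane slit along half of the first axis, exhibit the covering. *)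

theory Submission
  imports Defs
begin

section \<open>Quadrants and sectors as cones\<close>

text \<open>The vector \<open>c\<close> points into both open half-spaces, so adding a small
  positive multiple of \<open>c\<close> moves any point of the closed cone into the open
  one.\<close>

lemma closure_open_cone:
  fixes a b c :: "'a::euclidean_space"
  assumes "0 < a \<bullet> c" "0 < b \<bullet> c"
  shows "closure {x. 0 < a \<bullet> x \<and> 0 < b \<bullet> x} = {x. 0 \<le> a \<bullet> x \<and> 0 \<le> b \<bullet> x}" (is "closure ?O = ?C")
proof
  show "closure ?O \<subseteq> ?C"
  proof (rule closure_minimal)
    show "closed ?C"
      by (intro closed_Collect_conj closed_Collect_le continuous_intros)
  qed auto
  show "?C \<subseteq> closure ?O"
  proof
    fix x assume x: "x \<in> ?C"
    have "(\<lambda>n. x + (1 / real (Suc n)) *\<^sub>R c) \<longlonglongrightarrow> x + 0 *\<^sub>R c"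
      using LIMSEQ_Suc[OF lim_1_over_n] by (intro tendsto_intros)
    moreover have "x + (1 / real (Suc n)) *\<^sub>R c \<in> ?O" for n
      using x assms by (simp add: inner_add_right add_nonneg_pos)
    ultimately show "x \<in> closure ?O"
      unfolding closure_sequential by (metis (no_types, lifting) add.right_neutral scale_zero_left)
  qed
qed

abbreviation signs :: "real set" where
  "signs \<equiv> {1, -1}"

definition open_quadrant :: "real \<Rightarrow> real \<Rightarrow> (real ^ 2) set" where
  "open_quadrant s t = {x. 0 < s * x $ 1 \<and> 0 < t * x $ 2}"

definition quadrant :: "real \<Rightarrow> real \<Rightarrow> (real ^ 2) set" where
  "quadrant s t = {x. 0 \<le> s * x $ 1 \<and> 0 \<le> t * x $ 2}"

text \<open>In a sector, \<open>s\<close> and \<open>t\<close> are the signs of \<open>p\<close> and \<open>q\<close>, and \<open>w\<close> tells whether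
  \<open>\<bar>q\<bar> \<le> \<bar>p\<bar>\<close>.\<close>

definition open_sector :: "real \<Rightarrow> real \<Rightarrow> bool \<Rightarrow> (real ^ 2) set" where
  "open_sector s t w =
     (if w then {x. 0 < t * x $ 2 \<and> t * x $ 2 < s * x $ 1}
      else {x. 0 < s * x $ 1 \<and> s * x $ 1 < t * x $ 2})"

definition sector :: "real \<Rightarrow> real \<Rightarrow> bool \<Rightarrow> (real ^ 2) set" where
  "sector s t w =
     (if w then {x. 0 \<le> t * x $ 2 \<and> t * x $ 2 \<le> s * x $ 1}
      else {x. 0 \<le> s * x $ 1 \<and> s * x $ 1 \<le> t * x $ 2})"

text \<open>On the sector with parameters \<open>s\<close>, \<open>t\<close>, \<open>w\<close>,
  \<bar>p\<bar> = s p and \<bar>q\<bar> = t q, so - sgn (p q) min(\<bar>p\<bar>, \<bar>q\<bar>) is -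
  (s t) (t q) = - s q if \<open>w\<close> holds and - (s t) (s p) = - t p otherwise.\<close>

definition sector_map :: "real \<Rightarrow> real \<Rightarrow> bool \<Rightarrow> real ^ 2 \<Rightarrow> real ^ 2" where
  "sector_map s t w x = vector [if w then - s * x $ 2 else - t * x $ 1, s * x $ 1 - t * x $ 2]"

lemma inner_vector_2: "(vector [a, b] :: real ^ 2) \<bullet> x = a * x $ 1 + b * x $ 2"
  by (simp add: inner_vec_def sum_2)

text \<open>Here and in the next three lemmas the regions become intersections of two half-planes,
  so that general facts on closure, openness, convexity and polyhedra apply.\<close>

lemma open_quadrant_cone:
  "open_quadrant s t = {x. 0 < vector [s, 0] \<bullet> x \<and> 0 < vector [0, t] \<bullet> x}"
  by (simp add: open_quadrant_def inner_vector_2)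

lemma quadrant_cone:
  "quadrant s t = {x. 0 \<le> vector [s, 0] \<bullet> x \<and> 0 \<le> vector [0, t] \<bullet> x}"
  by (simp add: quadrant_def inner_vector_2)

lemma open_sector_cone:
  "open_sector s t w =
     {x. 0 < (if w then vector [0, t] else vector [s, 0]) \<bullet> x \<and>
         0 < (if w then vector [s, - t] else vector [- s, t]) \<bullet> x}"
  by (simp add: open_sector_def inner_vector_2)

lemma sector_cone:
  "sector s t w =
     {x. 0 \<le> (if w then vector [0, t] else vector [s, 0]) \<bullet> x \<and>
         0 \<le> (if w then vector [s, - t] else vector [- s, t]) \<bullet> x}"
  by (simp add: sector_def inner_vector_2)

lemma closure_open_quadrant:
  assumes "s \<in> signs" "t \<in> signs"
  shows "closure (open_quadrant s t) = quadrant s t"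
  unfolding open_quadrant_cone quadrant_cone
  by (rule closure_open_cone[where c = "vector [s, t]"]) (use assms in \<open>auto simp: inner_vector_2\<close>)

text \<open>The absolute values 2 and 1 keep the point off the axes and the bisectors. It shows that
  the open sector is nonempty, serves as the inward direction for \<open>closure_open_cone\<close>,
  and tells the closed sectors apart.\<close>

definition sector_point :: "real \<Rightarrow> real \<Rightarrow> bool \<Rightarrow> real ^ 2" where
  "sector_point s t w = (if w then vector [2 * s, t] else vector [s, 2 * t])"

lemma closure_open_sector:
  assumes "s \<in> signs" "t \<in> signs"
  shows "closure (open_sector s t w) = sector s t w"
  unfolding open_sector_cone sector_cone
  by (rule closure_open_cone[where c = "sector_point s t w"])
    (use assms in \<open>auto simp: inner_vector_2 sector_point_def\<close>)

lemma sector_point_in_open_sector: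
  "s \<in> signs \<Longrightarrow> t \<in> signs \<Longrightarrow> sector_point s t w \<in> open_sector s t w"
  by (auto simp: open_sector_def sector_point_def)

text \<open>Closed sectors share boundary rays, so their distinctness is read off from these points
  instead of from disjointness.\<close>

lemma sector_point_in_sector_iff:
  assumes "s \<in> signs" "t \<in> signs" "s' \<in> signs" "t' \<in> signs"
  shows "sector_point s t w \<in> sector s' t' w' \<longleftrightarrow> s = s' \<and> t = t' \<and> w = w'"
  using assms by (auto simp: sector_def sector_point_def)

section \<open>Components of the line complements; counting the sectors\<close>

lemma open_cone: "open {x::'a::euclidean_space. 0 < a \<bullet> x \<and> 0 < b \<bullet> x}"
  by (intro open_Collect_conj open_Collect_less continuous_intros)

lemma convex_cone_open: "convex {x::'a::euclidean_space. 0 < a \<bullet> x \<and> 0 < b \<bullet> x}"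
  using convex_Int[OF convex_halfspace_gt[of 0 a] convex_halfspace_gt[of 0 b]]
  by (simp add: Collect_conj_eq)

text \<open>Disjoint nonempty open connected sets that fill the complement are its components; the
  cones are connected because they are convex.\<close>

lemma components_quadrants:
  "components (- {x :: real ^ 2. x $ 1 = 0 \<or> x $ 2 = 0}) =
     (\<lambda>(s, t). open_quadrant s t) ` (signs \<times> signs)"
proof (rule components_open_unique)
  show "pairwise disjnt ((\<lambda>(s, t). open_quadrant s t) ` (signs \<times> signs))"
    by (auto simp: pairwise_def disjnt_iff open_quadrant_def)
  show "\<Union> ((\<lambda>(s, t). open_quadrant s t) ` (signs \<times> signs)) = - {x. x $ 1 = 0 \<or> x $ 2 = 0}"
    by (auto simp: open_quadrant_def)
  fix X assume "X \<in> (\<lambda>(s, t). open_quadrant s t) ` (signs \<times> signs)"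
  then obtain s t where st: "s \<in> signs" "t \<in> signs" and X: "X = open_quadrant s t"
    by auto
  have "vector [s, t] \<in> X"
    using st by (auto simp: X open_quadrant_def)
  moreover have "open X" "connected X"
    unfolding X open_quadrant_cone by (simp_all only: open_cone convex_connected convex_cone_open)
  ultimately show "open X \<and> connected X \<and> X \<noteq> {}" by blast
qed

lemma quadrants_eq: "quadrants = (\<lambda>(s, t). quadrant s t) ` (signs \<times> signs)"
  unfolding quadrants_def regions_bounded_by_def components_quadrants image_image
  by (intro image_cong refl) (auto simp: closure_open_quadrant)

text \<open>Any single point of an open sector determines the three parameters, so distinct open
  sectors are disjoint.\<close>

lemma open_sector_coordinates:
  assumes "s \<in> signs" "t \<in> signs" "x \<in> open_sector s t w"
  shows "s = sgn (x $ 1)" "t = sgn (x $ 2)" "w \<longleftrightarrow> \<bar>x $ 2\<bar> < \<bar>x $ 1\<bar>"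
  using assms by (cases w; auto simp: open_sector_def)+

lemma components_sectors:
  "components (- {x :: real ^ 2. x $ 1 = 0 \<or> x $ 2 = 0 \<or> x $ 1 = x $ 2 \<or> x $ 1 = - x $ 2}) =
     (\<lambda>(s, t, w). open_sector s t w) ` (signs \<times> signs \<times> UNIV)"
proof (rule components_open_unique)
  show "pairwise disjnt ((\<lambda>(s, t, w). open_sector s t w) ` (signs \<times> signs \<times> UNIV))"
  proof (rule pairwiseI)
    fix X Y :: "(real ^ 2) set"
    assume "X \<noteq> Y"
    assume "X \<in> (\<lambda>(s, t, w). open_sector s t w) ` (signs \<times> signs \<times> UNIV)"
    then obtain s t w where st: "s \<in> signs" "t \<in> signs" and X: "X = open_sector s t w"
      by auto
    assume "Y \<in> (\<lambda>(s, t, w). open_sector s t w) ` (signs \<times> signs \<times> UNIV)"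
    then obtain s' t' w' where st': "s' \<in> signs" "t' \<in> signs" and Y: "Y = open_sector s' t' w'"
      by auto
    have False if "x \<in> X" "x \<in> Y" for x
    proof -
      have "s = s'" "t = t'" "w = w'"
        using open_sector_coordinates[OF st that(1)[unfolded X]]
          open_sector_coordinates[OF st' that(2)[unfolded Y]] by (simp_all only:)
      then show False using \<open>X \<noteq> Y\<close> X Y by simp
    qed
    then show "disjnt X Y"
      unfolding disjnt_iff by blast
  qed
  show "\<Union> ((\<lambda>(s, t, w). open_sector s t w) ` (signs \<times> signs \<times> UNIV)) =
      - {x. x $ 1 = 0 \<or> x $ 2 = 0 \<or> x $ 1 = x $ 2 \<or> x $ 1 = - x $ 2}"
    by (auto simp: open_sector_def UNIV_bool)
  fix X assume "X \<in> (\<lambda>(s, t, w). open_sector s t w) ` (signs \<times> signs \<times> UNIV)"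
  then obtain s t w where st: "s \<in> signs" "t \<in> signs" and X: "X = open_sector s t w"
    by auto
  have "sector_point s t w \<in> X"
    using st by (simp only: X sector_point_in_open_sector)
  moreover have "open X" "connected X"
    unfolding X open_sector_cone by (simp_all only: open_cone convex_connected convex_cone_open)
  ultimately show "open X \<and> connected X \<and> X \<noteq> {}" by blast
qed

lemma sectors_eq: "sectors = (\<lambda>(s, t, w). sector s t w) ` (signs \<times> signs \<times> UNIV)"
  unfolding sectors_def regions_bounded_by_def components_sectors image_image
  by (intro image_cong refl) (auto simp: closure_open_sector)

lemma mem_sectors_iff:
  "X \<in> sectors \<longleftrightarrow> (\<exists>s\<in>signs. \<exists>t\<in>signs. \<exists>w. X = sector s t w)"
  by (simp only: sectors_eq image_iff split_paired_Bex_Sigma prod.case bex_UNIV)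

lemma card_sectors: "card sectors = 8"
proof -
  have "inj_on (\<lambda>(s, t, w). sector s t w) (signs \<times> signs \<times> UNIV)"
  proof (rule inj_onI, clarsimp simp del: insert_iff)
    fix s t w s' t' w'
    assume *: "s \<in> signs" "t \<in> signs" "s' \<in> signs" "t' \<in> signs"
      and "sector s t w = sector s' t' w'"
    then have "sector_point s t w \<in> sector s' t' w'"
      using sector_point_in_sector_iff[of s t s t w w] by auto
    then show "s = s' \<and> t = t' \<and> w = w'"
      using sector_point_in_sector_iff[OF *] by simp
  qed
  then show ?thesis
    unfolding sectors_eq by (simp add: card_image card_cartesian_product)
qed

lemma Union_sectors: "\<Union> sectors = UNIV"
proof -
  have "x \<in> \<Union> sectors" for x :: "real ^ 2"
  proof -
    \<comment> \<open>\<open>sgn\<close> would give 0 on an axis, which is not in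
      \<open>signs\<close>; the closed sectors admit either sign there, and 1 is chosen.\<close>
    define s t :: real
      where "s = (if 0 \<le> x $ 1 then 1 else - 1)" and "t = (if 0 \<le> x $ 2 then 1 else - 1)"
    have "x \<in> sector s t (\<bar>x $ 2\<bar> \<le> \<bar>x $ 1\<bar>)"
      by (simp add: sector_def s_def t_def)
    moreover have "s \<in> signs" "t \<in> signs"
      by (simp_all add: s_def t_def)
    ultimately show ?thesis
      by (metis UnionI mem_sectors_iff)
  qed
  then show ?thesis by blast
qed

section \<open>The linear maps on the sectors\<close>

lemma linear_sector_map: "linear (sector_map s t w)"
  by (rule linearI) (auto simp: sector_map_def vec_eq_iff forall_2 algebra_simps)

text \<open>The matrix rows are (0, -s), (s, -t) or (-t, 0), (s, -t), so the determinant is the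
  square of \<open>s\<close> or of \<open>t\<close>.\<close>

lemma det_sector_map:
  "s \<in> signs \<Longrightarrow> t \<in> signs \<Longrightarrow> det (matrix (sector_map s t w)) = 1"
  by (auto simp: det_2 matrix_def sector_map_def axis_def)

lemma Phi_R_sector:
  "s \<in> signs \<Longrightarrow> t \<in> signs \<Longrightarrow> x \<in> sector s t w \<Longrightarrow> Phi_R x = sector_map s t w x"
  by (auto simp: Phi_R_def sector_map_def sector_def vec_eq_iff forall_2 split: if_splits)

text \<open>A nonzero first coordinate of the image has sign - (s t), and the second, \<bar>p\<bar>
  - \<bar>q\<bar>, has its sign fixed by \<open>w\<close>.\<close>

lemma Phi_R_sector_image:
  assumes "s \<in> signs" "t \<in> signs"
  shows "Phi_R ` sector s t w = quadrant (- (s * t)) (if w then 1 else - 1)" (is "_ = ?Q")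
proof
  show "Phi_R ` sector s t w \<subseteq> ?Q"
    using assms by (auto simp: Phi_R_def sector_def quadrant_def split: if_splits)
  show "?Q \<subseteq> Phi_R ` sector s t w"
  proof
    fix y assume y: "y \<in> ?Q"
    \<comment> \<open>The smaller of \<bar>p\<bar> and \<bar>q\<bar> must be \<bar>y $ 1\<bar>; the
      larger then follows from \<bar>p\<bar> - \<bar>q\<bar> = y $ 2, and \<open>s\<close>,
      \<open>t\<close> supply the signs.\<close>
    define x :: "real ^ 2" where
      "x = (if w then vector [s * (\<bar>y $ 1\<bar> + y $ 2), t * \<bar>y $ 1\<bar>]
            else vector [s * \<bar>y $ 1\<bar>, t * (\<bar>y $ 1\<bar> - y $ 2)])"
    have "x \<in> sector s t w" "Phi_R x = y"
      using assms y
      by (auto simp: x_def sector_def quadrant_def Phi_R_def vec_eq_iff forall_2 split: if_splits)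
    then show "y \<in> Phi_R ` sector s t w" by blast
  qed
qed

lemma uminus_sector: "uminus ` sector s t w = sector (- s) (- t) w"
proof -
  have "x \<in> uminus ` sector s t w \<longleftrightarrow> - x \<in> sector s t w" for x
    by (metis image_iff minus_minus)
  then show ?thesis
    by (auto simp: sector_def)
qed

lemma Phi_R_even: "Phi_R (- x) = Phi_R x"
proof -
  have "\<bar>x $ 2 - x $ 1\<bar> = \<bar>x $ 1 - x $ 2\<bar>" "\<bar>- x $ 1 - x $ 2\<bar> = \<bar>x $ 1 + x $ 2\<bar>"
    by linarith+
  then show ?thesis
    by (simp add: Phi_R_def vec_eq_iff forall_2)
qed

section \<open>Continuity and right inverses\<close>

lemma continuous_on_vector_2:
  assumes "continuous_on S f" "continuous_on S g"
  shows "continuous_on S (\<lambda>x. vector [f x, g x] :: real ^ 2)"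
proof -
  have "(\<lambda>x. vector [f x, g x] :: real ^ 2) = (\<lambda>x. \<chi> i. if i = 1 then f x else g x)"
    by (auto simp: vec_eq_iff forall_2)
  moreover have "continuous_on S (\<lambda>x. if i = 1 then f x else g x)" for i :: 2
    using assms by (cases "i = 1") simp_all
  ultimately show ?thesis
    by (simp only: continuous_on_vec_lambda)
qed

lemma continuous_Phi_R: "continuous_on S Phi_R"
  unfolding Phi_R_def by (intro continuous_on_vector_2 continuous_intros) auto

text \<open>Two right inverses of \<open>Phi_R\<close>, continuous off the nonnegative and off the nonpositive
  first axis, respectively.\<close>

definition right_inverse_1 :: "real ^ 2 \<Rightarrow> real ^ 2" where
  "right_inverse_1 y =
     (if y $ 2 \<le> 0 then vector [- y $ 1, \<bar>y $ 1\<bar> - y $ 2] else vector [y $ 2 + \<bar>y $ 1\<bar>, - y $ 1])"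

definition right_inverse_2 :: "real ^ 2 \<Rightarrow> real ^ 2" where
  "right_inverse_2 y =
     (if y $ 2 \<le> 0 then vector [y $ 1, y $ 2 - \<bar>y $ 1\<bar>] else vector [y $ 2 + \<bar>y $ 1\<bar>, - y $ 1])"

lemma Phi_R_right_inverse_1: "Phi_R (right_inverse_1 y) = y"
  by (auto simp: Phi_R_def right_inverse_1_def vec_eq_iff forall_2)

lemma Phi_R_right_inverse_2: "Phi_R (right_inverse_2 y) = y"
  by (auto simp: Phi_R_def right_inverse_2_def vec_eq_iff forall_2)

text \<open>On the line \<open>y $ 2 = 0\<close> the two branches agree for \<open>y $ 1 < 0\<close>
  and are opposite for \<open>y $ 1 > 0\<close>, which puts the slit on the latter side.\<close>

lemma continuous_on_right_inverse_1:
  "continuous_on {y. 0 \<le> y $ 1 \<longrightarrow> y $ 2 \<noteq> 0} right_inverse_1"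
  unfolding right_inverse_1_def
  by (intro continuous_on_cases_le continuous_on_vector_2 continuous_intros) auto

text \<open>The branch for \<open>y $ 2 \<le> 0\<close> is the negative of that in
  \<open>right_inverse_1\<close>, so agreement and opposition trade places.\<close>

lemma continuous_on_right_inverse_2:
  "continuous_on {y. y $ 1 \<le> 0 \<longrightarrow> y $ 2 \<noteq> 0} right_inverse_2"
  unfolding right_inverse_2_def
  by (intro continuous_on_cases_le continuous_on_vector_2 continuous_intros) auto

section \<open>Fibres and the branched double covering\<close>

lemma in_some_sector:
  obtains s t w where "s \<in> signs" "t \<in> signs" "x \<in> sector s t w"
  by (metis UNIV_I Union_sectors Union_iff mem_sectors_iff)

text \<open>The branch depends on the sign of \<open>s * x $ 1 - t * x $ 2\<close>. On the bisectors
  \<open>w\<close> may hold although the branch for \<open>y $ 2 \<le> 0\<close> applies, hence the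
  strict inequality in the factor.\<close>

lemma right_inverse_1_sector_map:
  assumes "s \<in> signs" "t \<in> signs" "x \<in> sector s t w"
  shows "right_inverse_1 (sector_map s t w x) = (if w \<and> t * x $ 2 < s * x $ 1 then s else t) *\<^sub>R x"
  using assms
  by (auto simp: right_inverse_1_def sector_map_def sector_def vec_eq_iff forall_2 split: if_splits)

lemma right_inverse_1_Phi_R: "right_inverse_1 (Phi_R x) = x \<or> right_inverse_1 (Phi_R x) = - x"
proof -
  obtain s t w where st: "s \<in> signs" "t \<in> signs" "x \<in> sector s t w"
    by (rule in_some_sector)
  show ?thesis
    unfolding Phi_R_sector[OF st] right_inverse_1_sector_map[OF st] using st(1,2) by auto
qed

text \<open>If the images agree, \<open>right_inverse_1\<close> of the common value equals both
  \<open>x\<close> and \<open>y\<close> up to sign; the converse is evenness.\<close>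

lemma Phi_R_eq_iff: "Phi_R x = Phi_R y \<longleftrightarrow> x = y \<or> x = - y"
  by (metis right_inverse_1_Phi_R Phi_R_even minus_minus)

lemma Phi_R_eq_0_iff: "Phi_R x = 0 \<longleftrightarrow> x = 0"
  using Phi_R_eq_iff[of x 0] by (simp add: Phi_R_def vec_eq_iff forall_2)

text \<open>The sheets over the domain \<open>T\<close> of a continuous right inverse \<open>g\<close> are the images of \<open>T\<close>
  under \<open>g\<close> and \<open>- g\<close>; they are open by invariance of domain.\<close>

lemma Phi_R_evenly_covered:
  assumes T: "open T" "0 \<notin> T" and g: "continuous_on T g" "\<And>y. Phi_R (g y) = y"
  shows "\<exists>v. \<Union>v = (UNIV - {0}) \<inter> Phi_R -` T \<and>
             (\<forall>u\<in>v. openin (top_of_set (UNIV - {0})) u) \<and>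
             pairwise disjnt v \<and> (\<forall>u\<in>v. \<exists>q. homeomorphism u T Phi_R q)"
proof (intro exI conjI)
  let ?g' = "\<lambda>y. - g y"
  let ?v = "{g ` T, ?g' ` T}"
  have g': "continuous_on T ?g'" "\<And>y. Phi_R (?g' y) = y"
    using g by (auto intro: continuous_on_minus simp: Phi_R_even)
  have sheet: "openin (top_of_set (UNIV - {0})) (h ` T) \<and> homeomorphism (h ` T) T Phi_R h"
    if h: "continuous_on T h" "\<And>y. Phi_R (h y) = y" for h
  proof
    have "inj_on h T" by (metis h(2) inj_onI)
    then have "open (h ` T)" using invariance_of_domain h(1) T(1) by blast
    moreover have "0 \<notin> h ` T" using h(2) T(2) Phi_R_eq_0_iff by (metis imageE)
    ultimately show "openin (top_of_set (UNIV - {0})) (h ` T)"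
      by (auto intro: open_subset)
    show "homeomorphism (h ` T) T Phi_R h"
      using h by (auto simp: homeomorphism_def continuous_Phi_R image_image)
  qed
  show "\<forall>u\<in>?v. openin (top_of_set (UNIV - {0})) u" "\<forall>u\<in>?v. \<exists>q. homeomorphism u T Phi_R q"
    using sheet[OF g] sheet[OF g'] by auto
  show "\<Union>?v = (UNIV - {0}) \<inter> Phi_R -` T"
  proof (intro set_eqI iffI)
    fix x assume "x \<in> \<Union>?v"
    then have "Phi_R x \<in> T"
      using g(2) g'(2) by auto
    then show "x \<in> (UNIV - {0}) \<inter> Phi_R -` T"
      using T(2) Phi_R_eq_0_iff[of x] by (cases "x = 0") simp_all
  next
    fix x assume x: "x \<in> (UNIV - {0}) \<inter> Phi_R -` T"
    have "Phi_R x = Phi_R (g (Phi_R x))" by (simp add: g(2))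
    then have "x = g (Phi_R x) \<or> x = ?g' (Phi_R x)" by (simp only: Phi_R_eq_iff)
    then show "x \<in> \<Union>?v" using x by blast
  qed
  \<comment> \<open>Applying \<open>Phi_R\<close> to a common point \<open>g y = - g z\<close> gives
    \<open>y = z\<close>, hence \<open>g y = 0\<close> and \<open>y = 0\<close>, which is not in
    \<open>T\<close>.\<close>
  have "g ` T \<inter> ?g' ` T = {}"
  proof (rule ccontr)
    assume "g ` T \<inter> ?g' ` T \<noteq> {}"
    then obtain y z where yz: "y \<in> T" "z \<in> T" "g y = - g z" by blast
    then have "y = z" by (metis g(2) g'(2))
    then have "g y = - g y" using yz(3) by (simp only:)
    then have "g y = 0" by (simp add: vec_eq_iff)
    then show False using g(2)[of y] Phi_R_eq_0_iff[of 0] yz(1) T(2) by simp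
  qed
  then show "pairwise disjnt ?v"
    by (auto simp: pairwise_def disjnt_def)
qed

text \<open>The domains of the two right inverses are open, evenly covered, and together fill the
  punctured plane.\<close>

lemma covering_space_Phi_R: "covering_space (UNIV - {0}) Phi_R (UNIV - {0})"
proof -
  have image: "Phi_R ` (UNIV - {0}) = UNIV - {0}"
  proof (intro set_eqI iffI)
    fix y :: "real ^ 2" assume "y \<in> UNIV - {0}"
    then have "right_inverse_1 y \<in> UNIV - {0}"
      using Phi_R_eq_0_iff[of "right_inverse_1 y"] by (simp add: Phi_R_right_inverse_1)
    then show "y \<in> Phi_R ` (UNIV - {0})"
      using Phi_R_right_inverse_1[of y, symmetric] by (rule rev_image_eqI)
  qed (auto simp: Phi_R_eq_0_iff)
  have open1: "open {y :: real ^ 2. 0 \<le> y $ 1 \<longrightarrow> y $ 2 \<noteq> 0}" (is "open ?T1")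
    by (simp only: imp_conv_disj not_le)
      (intro open_Collect_disj open_Collect_less open_Collect_neq continuous_intros)
  have open2: "open {y :: real ^ 2. y $ 1 \<le> 0 \<longrightarrow> y $ 2 \<noteq> 0}" (is "open ?T2")
    by (simp only: imp_conv_disj not_le)
      (intro open_Collect_disj open_Collect_less open_Collect_neq continuous_intros)
  have zero: "0 \<notin> ?T1" "0 \<notin> ?T2"
    by auto
  note cover =
    Phi_R_evenly_covered[OF open1 zero(1) continuous_on_right_inverse_1 Phi_R_right_inverse_1]
    Phi_R_evenly_covered[OF open2 zero(2) continuous_on_right_inverse_2 Phi_R_right_inverse_2]
  have openin: "openin (top_of_set (UNIV - {0})) ?T1" "openin (top_of_set (UNIV - {0})) ?T2"
    using open1 open2 zero by (auto intro!: open_subset)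
  show ?thesis
    unfolding covering_space_def
  proof (intro conjI continuous_Phi_R image ballI)
    fix y :: "real ^ 2" assume "y \<in> UNIV - {0}"
    then have "y \<in> ?T1 \<or> y \<in> ?T2"
      by (auto simp: vec_eq_iff forall_2)
    then consider "y \<in> ?T1" | "y \<in> ?T2"
      by blast
    then show "\<exists>T. y \<in> T \<and> openin (top_of_set (UNIV - {0})) T \<and>
        (\<exists>v. \<Union>v = (UNIV - {0}) \<inter> Phi_R -` T \<and>
             (\<forall>u\<in>v. openin (top_of_set (UNIV - {0})) u) \<and>
             pairwise disjnt v \<and> (\<forall>u\<in>v. \<exists>q. homeomorphism u T Phi_R q))"
    proof cases
      case 1
      show ?thesis by (intro exI[of _ ?T1] conjI 1 openin(1) cover(1))
    next
      case 2
      show ?thesis by (intro exI[of _ ?T2] conjI 2 openin(2) cover(2))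
    qed
  qed
qed

lemma double_covering_Phi_R: "double_covering_branched_at_origin Phi_R"
  unfolding double_covering_branched_at_origin_def
proof (intro conjI ballI covering_space_Phi_R)
  show "Phi_R -` {0} = {0}"
    by (auto simp: Phi_R_eq_0_iff)
  fix y :: "real ^ 2" assume y: "y \<in> UNIV - {0}"
  let ?x = "right_inverse_1 y"
  have x: "Phi_R ?x = y" by (rule Phi_R_right_inverse_1)
  then have "?x \<noteq> 0" using y Phi_R_eq_0_iff[of ?x] by simp
  then have "?x \<noteq> - ?x" by (auto simp: vec_eq_iff)
  have "{x \<in> UNIV - {0}. Phi_R x = y} = {?x, - ?x}"
    using \<open>?x \<noteq> 0\<close> Phi_R_eq_iff[of _ ?x, unfolded x] by auto
  then show "card {x \<in> UNIV - {0}. Phi_R x = y} = 2"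
    using \<open>?x \<noteq> - ?x\<close> by simp
qed

section \<open>Piecewise linearity and area preservation\<close>

lemma open_sector_subset: "open_sector s t w \<subseteq> sector s t w"
  by (auto simp: open_sector_def sector_def)

lemma linear_piece_sector:
  assumes "s \<in> signs" "t \<in> signs"
  shows "linear_piece Phi_R (sector s t w) (sector_map s t w) 0"
  unfolding linear_piece_def
proof (intro conjI linear_sector_map ballI)
  show "polyhedron (sector s t w)"
    unfolding sector_cone Collect_conj_eq by (intro polyhedron_Int polyhedron_halfspace_ge)
  have "open_sector s t w \<subseteq> interior (sector s t w)"
    by (rule interior_maximal[OF open_sector_subset]) (unfold open_sector_cone, rule open_cone)
  then show "interior (sector s t w) \<noteq> {}"
    using sector_point_in_open_sector[OF assms] by blast
qed (simp add: Phi_R_sector[OF assms])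

lemma piecewise_linear_Phi_R: "piecewise_linear Phi_R"
  unfolding piecewise_linear_def
proof (intro conjI continuous_Phi_R exI)
  show "finite sectors" by (simp add: sectors_eq)
  show "\<Union>sectors = UNIV" by (rule Union_sectors)
  show "\<forall>X\<in>sectors. \<exists>L b. linear_piece Phi_R X L b"
    using linear_piece_sector mem_sectors_iff by metis
qed

text \<open>Near \<open>x\<close> the two maps coincide, so \<open>L\<close> and \<open>M\<close>
  are both the derivative of \<open>M\<close> at \<open>x\<close>, and derivatives are
  unique.\<close>

lemma linear_eq_of_affine_eq_on_open:
  fixes L M :: "'a::euclidean_space \<Rightarrow> 'b::real_normed_vector"
  assumes "linear L" "linear M" "open U" "x \<in> U"
    and eq: "\<And>y. y \<in> U \<Longrightarrow> L y + b = M y"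
  shows "L = M"
proof (rule has_derivative_unique)
  show "(M has_derivative M) (at x)"
    using assms(2) by (simp add: linear_imp_has_derivative)
  have "((\<lambda>y. L y + b) has_derivative L) (at x)"
    using linear_imp_has_derivative[OF assms(1)] by (simp add: has_derivative_add_const)
  then show "(M has_derivative L) (at x)"
    using has_derivative_transform_within_open assms(3,4) eq by blast
qed

text \<open>The interior of any linear piece meets an open sector, on which \<open>Phi_R\<close> is one of the eight
  maps \<open>sector_map s t w\<close>.\<close>

lemma area_preserving_Phi_R: "area_preserving Phi_R"
  unfolding area_preserving_def
proof (intro allI impI)
  fix X L b assume "linear_piece Phi_R X L b"
  then have L: "linear L" and X: "interior X \<noteq> {}" and eq: "\<And>x. x \<in> X \<Longrightarrow> Phi_R x = L x + b"
    by (auto simp: linear_piece_def)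
  obtain x where x: "x \<in> interior X" using X by blast
  obtain s t w where st: "s \<in> signs" "t \<in> signs" and "x \<in> sector s t w"
    by (rule in_some_sector)
  \<comment> \<open>The piece \<open>X\<close> is arbitrary and \<open>x\<close> may lie on a sector
    boundary; since an open set meeting a closure meets the set itself, \<open>x\<close> can be
    traded for a point inside the open sector.\<close>
  then have "interior X \<inter> closure (open_sector s t w) \<noteq> {}"
    using x closure_open_sector by blast
  then obtain z where z: "z \<in> interior X \<inter> open_sector s t w"
    using open_Int_closure_eq_empty[OF open_interior] by blast
  have "L = sector_map s t w"
  proof (rule linear_eq_of_affine_eq_on_open[OF L linear_sector_map _ z])
    show "open (interior X \<inter> open_sector s t w)"
      unfolding open_sector_cone by (intro open_Int open_interior open_cone)
    fix y assume y: "y \<in> interior X \<inter> open_sector s t w"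
    then show "L y + b = sector_map s t w y"
      using eq Phi_R_sector[OF st] interior_subset[of X] open_sector_subset[of s t w]
      by (metis IntE subsetD)
  qed
  then show "\<bar>det (matrix L)\<bar> = 1"
    by (simp add: det_sector_map[OF st])
qed

section \<open>The integer map and its quotient\<close>

text \<open>The embedding of integer vectors into the real plane is injective and intertwines
  \<open>Phi\<close> with \<open>Phi_R\<close>, so the fibres are inherited.\<close>

lemma Phi_eq_iff: "Phi x = Phi y \<longleftrightarrow> x = y \<or> x = - y"
proof -
  let ?r = "\<lambda>x :: int ^ 2. (\<chi> i. real_of_int (x $ i)) :: real ^ 2"
  have r: "?r x = ?r y \<longleftrightarrow> x = y" for x y
    by (simp add: vec_eq_iff)
  have "Phi x = Phi y \<longleftrightarrow> Phi_R (?r x) = Phi_R (?r y)"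
    by (simp only: Phi_R_extends_Phi r)
  also have "\<dots> \<longleftrightarrow> ?r x = ?r y \<or> ?r x = - ?r y"
    by (rule Phi_R_eq_iff)
  also have "- ?r y = ?r (- y)"
    by (simp add: vec_eq_iff)
  finally show ?thesis by (simp only: r)
qed

lemma surj_Phi: "surj Phi"
proof (rule surjI)
  fix y :: "int ^ 2"
  \<comment> \<open>This is the formula of \<open>right_inverse_1\<close>, which takes integer
    points to integer points.\<close>
  show "Phi (if y $ 2 \<le> 0 then vector [- y $ 1, \<bar>y $ 1\<bar> - y $ 2]
             else vector [y $ 2 + \<bar>y $ 1\<bar>, - y $ 1]) = y"
    by (auto simp: Phi_def vec_eq_iff forall_2 abs_if)
qed

text \<open>The classes of \<open>r\<close> are exactly the fibres of \<open>f\<close>, so each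
  class has a singleton image, from which \<open>the_elem\<close> extracts the induced
  value.\<close>

lemma bij_betw_the_elem_quotient:
  assumes "equiv UNIV r" "\<And>x y. f x = f y \<longleftrightarrow> (x, y) \<in> r" "surj f"
  shows "bij_betw (\<lambda>X. the_elem (f ` X)) (UNIV // r) UNIV"
    and "the_elem (f ` (r `` {x})) = f x"
proof -
  have lift: "the_elem (f ` (r `` {x})) = f x" for x
  proof -
    have "f ` (r `` {x}) = {f x}"
      by (auto simp: assms(2)[symmetric] intro!: image_eqI[of _ f x])
    then show ?thesis by simp
  qed
  show "the_elem (f ` (r `` {x})) = f x" by (rule lift)
  have "inj_on (\<lambda>X. the_elem (f ` X)) (UNIV // r)"
  proof (rule inj_onI)
    fix X Y assume XY: "X \<in> UNIV // r" "Y \<in> UNIV // r" "the_elem (f ` X) = the_elem (f ` Y)"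
    obtain x y where "X = r `` {x}" "Y = r `` {y}"
      using XY(1,2) by (elim quotientE)
    moreover from this have "(x, y) \<in> r"
      using XY(3) by (simp add: lift assms(2))
    ultimately show "X = Y"
      using equiv_class_eq[OF assms(1)] by simp
  qed
  moreover have "(\<lambda>X. the_elem (f ` X)) ` (UNIV // r) = range f"
    by (simp add: quotient_def UNION_singleton_eq_range image_image lift)
  ultimately show "bij_betw (\<lambda>X. the_elem (f ` X)) (UNIV // r) UNIV"
    using assms(3) by (simp add: bij_betw_def)
qed

section \<open>Sectors onto quadrants, and assembly\<close>

text \<open>Negation flips both \<open>s\<close> and \<open>t\<close> and keeps \<open>w\<close>, so
  it permutes the sectors; opposite sectors have the same image by evenness.\<close>

lemma Phi_R_sectors:
  assumes "X \<in> sectors"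
  shows "uminus ` X \<in> sectors \<and>
        (\<exists>Q\<in>quadrants. (\<exists>L. linear L \<and> (\<forall>x\<in>X. Phi_R x = L x)) \<and>
           Phi_R ` X = Q \<and> Phi_R ` (uminus ` X) = Q)"
proof -
  obtain s t w where st: "s \<in> signs" "t \<in> signs" and X: "X = sector s t w"
    using assms mem_sectors_iff by metis
  have "uminus ` X \<in> sectors"
    unfolding X uminus_sector sectors_eq using st
    by (intro image_eqI[where x = "(- s, - t, w)"]) auto
  moreover have "Phi_R ` X \<in> quadrants"
    unfolding X Phi_R_sector_image[OF st] quadrants_eq using st
    by (intro image_eqI[where x = "(- (s * t), if w then 1 else - 1)"]) auto
  moreover have "\<forall>x\<in>X. Phi_R x = sector_map s t w x"
    using Phi_R_sector[OF st] X by blast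
  moreover have "Phi_R ` (uminus ` X) = Phi_R ` X"
    by (simp add: image_image Phi_R_even)
  ultimately show ?thesis
    by (intro conjI bexI[of _ "Phi_R ` X"] exI[of _ "sector_map s t w"] linear_sector_map refl)
qed

theorem theorem4p3:
  "(piecewise_linear Phi_R \<and> area_preserving Phi_R) \<and>
   (double_covering_branched_at_origin Phi_R \<and> (\<forall>x. Phi_R (- x) = Phi_R x)) \<and>
   (card sectors = 8 \<and>
     (\<forall>X\<in>sectors. uminus ` X \<in> sectors \<and>
        (\<exists>Q\<in>quadrants. (\<exists>L. linear L \<and> (\<forall>x\<in>X. Phi_R x = L x)) \<and>
           Phi_R ` X = Q \<and> Phi_R ` (uminus ` X) = Q))) \<and>
   (range Phi = UNIV \<and>
     (\<exists>g. bij_betw g (UNIV // neg_rel) UNIV \<and> (\<forall>x. g (neg_rel `` {x}) = Phi x)))"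
proof -
  have "Phi x = Phi y \<longleftrightarrow> (x, y) \<in> neg_rel" for x y
    by (auto simp: Phi_eq_iff neg_rel_def)
  then have "\<exists>g. bij_betw g (UNIV // neg_rel) UNIV \<and> (\<forall>x. g (neg_rel `` {x}) = Phi x)"
    using bij_betw_the_elem_quotient[OF equiv_neg_rel _ surj_Phi] by blast
  with piecewise_linear_Phi_R area_preserving_Phi_R double_covering_Phi_R card_sectors surj_Phi
  show ?thesis
    by (intro conjI allI ballI Phi_R_even Phi_R_sectors)
qed

end
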